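(* Let $(G,\cdot,\rhd,\Phi)$ be a twisted post-group with sub-adjacent operation $\circ$, and let $a\in G$. Then $(G_a,\circ)$, where $G_a=\{b\circ e_a\mid b\in G\}$, is a group with identity element $e_a$.
   Context: A (left) twisted post-group $(G,\cdot,\rhd,\Phi)$ is a group $(G,\cdot)$ with maps $\rhd:G\times G\to G$ and $\Phi:G\to G$ such that, setting $a\circ b=\Phi(a)\cdot(a\rhd b)$ (the sub-adjacent operation), for all $a,b,c\in G$: (1) $L_a^{\rhd}:G\to G$, $L_a^{\rhd}(b)=a\rhd b$, is a group automorphism of $(G,\cdot)$; (2) $(a\circ b)\rhd c=a\rhd(b\rhd c)$; (3) $\Phi(a\circ b)=a\circ\Phi(b)$. For $a\in G$ put $e_a=(L_a^{\rhd})^{-1}(\Phi(a)^{-1}\cdot a)$, where the inverse of $\Phi(a)$ is taken in $(G,\cdot)$. *)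

theory Defs
  imports "HOL-Algebra.Group"
begin

definition sub_adjacent ::
  "('a, 'm) monoid_scheme \<Rightarrow> ('a \<Rightarrow> 'a \<Rightarrow> 'a) \<Rightarrow> ('a \<Rightarrow> 'a) \<Rightarrow> 'a \<Rightarrow> 'a \<Rightarrow> 'a"
  where "sub_adjacent G rhd \<Phi> a b = \<Phi> a \<otimes>\<^bsub>G\<^esub> rhd a b"

(* L_a is the partially applied function rhd a; iso G G is the set of group
   automorphisms of G, without the extensionality that auto G would demand. *)
locale twisted_post_group = group G
  for G (structure) and rhd :: "'a \<Rightarrow> 'a \<Rightarrow> 'a" (infixr \<open>\<rhd>\<close> 75) and \<Phi> :: "'a \<Rightarrow> 'a" +
  assumes Phi_closed: "\<Phi> \<in> carrier G \<rightarrow> carrier G"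
    and L_automorphism: "a \<in> carrier G \<Longrightarrow> rhd a \<in> iso G G"
    and sub_adjacent_action:
      "\<lbrakk>a \<in> carrier G; b \<in> carrier G; c \<in> carrier G\<rbrakk>
        \<Longrightarrow> sub_adjacent G rhd \<Phi> a b \<rhd> c = a \<rhd> (b \<rhd> c)"
    and Phi_sub_adjacent:
      "\<lbrakk>a \<in> carrier G; b \<in> carrier G\<rbrakk>
        \<Longrightarrow> \<Phi> (sub_adjacent G rhd \<Phi> a b) = sub_adjacent G rhd \<Phi> a (\<Phi> b)"

definition local_unit ::
  "('a, 'm) monoid_scheme \<Rightarrow> ('a \<Rightarrow> 'a \<Rightarrow> 'a) \<Rightarrow> ('a \<Rightarrow> 'a) \<Rightarrow> 'a \<Rightarrow> 'a"
  where "local_unit G rhd \<Phi> a =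
    inv_into (carrier G) (rhd a) (inv\<^bsub>G\<^esub> (\<Phi> a) \<otimes>\<^bsub>G\<^esub> a)"

definition local_carrier ::
  "('a, 'm) monoid_scheme \<Rightarrow> ('a \<Rightarrow> 'a \<Rightarrow> 'a) \<Rightarrow> ('a \<Rightarrow> 'a) \<Rightarrow> 'a \<Rightarrow> 'a set"
  where "local_carrier G rhd \<Phi> a =
    {sub_adjacent G rhd \<Phi> b (local_unit G rhd \<Phi> a) | b. b \<in> carrier G}"

end

theory Submission
  imports Defs
begin

text \<open>
  The operation \<open>a \<odot> b = \<Phi>(a) \<cdot> (a \<rhd> b)\<close> is associative, because
  \<open>\<Phi>(a \<odot> b) = a \<odot> \<Phi>(b)\<close> and the maps \<open>L_a\<close> are multiplicative and compose
  along \<open>\<odot>\<close>. Moreover \<open>b \<mapsto> a \<odot> b\<close> is \<open>L_a\<close> followed by a left translation of the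
  group, hence a bijection. So the carrier with \<open>\<odot>\<close> is what semigroup theory calls a right
  group: every equation \<open>a \<odot> x = b\<close> has exactly one solution.

  The element \<open>e_a\<close> is the solution of \<open>a \<odot> x = a\<close>, and cancelling \<open>a\<close> in
  \<open>a \<odot> (e_a \<odot> e_a) = a \<odot> e_a\<close> shows that it is idempotent. In a right group every
  idempotent \<open>e\<close> is a left identity, and it becomes a two-sided one on the
  elements \<open>b \<odot> e\<close>; solvability of equations then supplies inverses there
  (\<open>group_of_idempotent\<close>).
\<close>

text \<open>
  Cancellation turns idempotence of \<open>e\<close> into \<open>e \<cdot> x = x\<close>, so only \<open>x \<cdot> e = x\<close> can fail;
  the elements that satisfy it are those of the form \<open>b \<cdot> e\<close>. If \<open>y\<close> solves
  \<open>x \<cdot> y = e\<close>, then \<open>y \<cdot> e\<close> is a right inverse of \<open>x\<close> of that form, and it is also a left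
  inverse: \<open>x \<cdot> ((y \<cdot> e) \<cdot> x) = e \<cdot> x = x \<cdot> e\<close>, where \<open>x\<close> can be cancelled.
\<close>

lemma group_of_idempotent:
  fixes S :: "'a set" and f :: "'a \<Rightarrow> 'a \<Rightarrow> 'a" (infixl \<open>\<cdot>\<close> 70)
  assumes bij: "\<And>x. x \<in> S \<Longrightarrow> bij_betw (f x) S S"
    and assoc: "\<And>x y z. \<lbrakk>x \<in> S; y \<in> S; z \<in> S\<rbrakk> \<Longrightarrow> (x \<cdot> y) \<cdot> z = x \<cdot> (y \<cdot> z)"
    and e: "e \<in> S" and idem: "e \<cdot> e = e"
  shows "group \<lparr>carrier = {b \<cdot> e | b. b \<in> S}, monoid.mult = f, one = e\<rparr>"
proof -
  have closed: "x \<cdot> y \<in> S" if "x \<in> S" "y \<in> S" for x y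
    using bij_betwE[OF bij[OF that(1)]] that(2) by simp
  have cancel: "y = z" if "x \<cdot> y = x \<cdot> z" "x \<in> S" "y \<in> S" "z \<in> S" for x y z
    using bij_betw_imp_inj_on[OF bij[OF that(2)]] that by (simp add: inj_on_eq_iff)
  have left_unit: "e \<cdot> x = x" if "x \<in> S" for x
    by (rule cancel[of e]) (use assoc[OF e e that] that in \<open>simp_all add: e idem closed\<close>)
  have carrier_eq: "{b \<cdot> e | b. b \<in> S} = {x \<in> S. x \<cdot> e = x}" (is "?L = ?R")
  proof
    show "?L \<subseteq> ?R"
      by (auto simp: assoc closed e idem)
    show "?R \<subseteq> ?L"
      by force
  qed
  show ?thesis
    unfolding carrier_eq
  proof (rule groupI, simp_all add: assoc closed e idem left_unit)
    fix x
    assume "x \<in> S \<and> x \<cdot> e = x"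
    then have x: "x \<in> S" "x \<cdot> e = x"
      by simp_all
    obtain y where y: "y \<in> S" "x \<cdot> y = e"
      using bij_betw_imp_surj_on[OF bij[OF x(1)]] e by (metis imageE)
    have "x \<cdot> ((y \<cdot> e) \<cdot> x) = ((x \<cdot> y) \<cdot> e) \<cdot> x"
      using x(1) y(1) e by (simp add: assoc closed)
    also have "\<dots> = x \<cdot> e"
      using x y(2) by (simp add: idem left_unit)
    finally have "(y \<cdot> e) \<cdot> x = e"
      by (rule cancel) (simp_all add: x(1) y(1) e closed)
    moreover have "y \<cdot> e \<in> S" "(y \<cdot> e) \<cdot> e = y \<cdot> e"
      using y(1) e by (simp_all add: assoc closed idem)
    ultimately show "\<exists>z. z \<in> S \<and> z \<cdot> e = z \<and> z \<cdot> x = e"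
      by metis
  qed
qed

context twisted_post_group
begin

abbreviation sub_adj (infixl \<open>\<odot>\<close> 70)
  where "x \<odot> y \<equiv> sub_adjacent G rhd \<Phi> x y"

lemma Phi_in_carrier: "x \<in> carrier G \<Longrightarrow> \<Phi> x \<in> carrier G"
  using Phi_closed by blast

lemma rhd_bij: "x \<in> carrier G \<Longrightarrow> bij_betw (rhd x) (carrier G) (carrier G)"
  using L_automorphism by (simp add: iso_def)

lemma rhd_closed: "\<lbrakk>x \<in> carrier G; y \<in> carrier G\<rbrakk> \<Longrightarrow> x \<rhd> y \<in> carrier G"
  using rhd_bij bij_betwE by blast

lemma rhd_mult:
  "\<lbrakk>x \<in> carrier G; y \<in> carrier G; z \<in> carrier G\<rbrakk> \<Longrightarrow> x \<rhd> (y \<otimes> z) = (x \<rhd> y) \<otimes> (x \<rhd> z)"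
  using L_automorphism by (simp add: iso_def hom_mult)

lemma sub_adjacent_bij:
  assumes x: "x \<in> carrier G"
  shows "bij_betw (sub_adjacent G rhd \<Phi> x) (carrier G) (carrier G)"
proof -
  have "bij_betw (\<lambda>y. \<Phi> x \<otimes> y) (carrier G) (carrier G)"
    using Phi_in_carrier[OF x] by (simp add: bij_betw_def inj_on_cmult surj_const_mult)
  with rhd_bij[OF x] have "bij_betw ((\<lambda>y. \<Phi> x \<otimes> y) \<circ> rhd x) (carrier G) (carrier G)"
    by (rule bij_betw_trans)
  moreover have "(\<lambda>y. \<Phi> x \<otimes> y) \<circ> rhd x = sub_adjacent G rhd \<Phi> x"
    by (simp add: fun_eq_iff sub_adjacent_def)
  ultimately show ?thesis
    by simp
qed

text \<open>
  The axiom for \<open>\<Phi>\<close>, the action axiom and multiplicativity of \<open>L_x\<close> bring both sides to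
  \<open>\<Phi>(x) \<cdot> (x \<rhd> \<Phi>(y)) \<cdot> (x \<rhd> (y \<rhd> z))\<close>.
\<close>

lemma sub_adjacent_assoc:
  assumes x: "x \<in> carrier G" and y: "y \<in> carrier G" and z: "z \<in> carrier G"
  shows "(x \<odot> y) \<odot> z = x \<odot> (y \<odot> z)"
proof -
  have "(x \<odot> y) \<odot> z = \<Phi> (x \<odot> y) \<otimes> ((x \<odot> y) \<rhd> z)"
    by (rule sub_adjacent_def)
  also have "\<dots> = (x \<odot> \<Phi> y) \<otimes> (x \<rhd> (y \<rhd> z))"
    by (simp add: Phi_sub_adjacent sub_adjacent_action x y z)
  also have "\<dots> = x \<odot> (y \<odot> z)"
    by (simp add: sub_adjacent_def rhd_mult rhd_closed Phi_in_carrier m_assoc x y z)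
  finally show ?thesis .
qed

lemma local_unit_closed:
  assumes "x \<in> carrier G"
  shows "local_unit G rhd \<Phi> x \<in> carrier G"
  unfolding local_unit_def
  using assms bij_betw_imp_surj_on[OF rhd_bij[OF assms]]
  by (intro inv_into_into) (simp add: Phi_in_carrier)

lemma sub_adjacent_local_unit:
  assumes x: "x \<in> carrier G"
  shows "x \<odot> local_unit G rhd \<Phi> x = x"
proof -
  have "x \<rhd> local_unit G rhd \<Phi> x = inv (\<Phi> x) \<otimes> x"
    unfolding local_unit_def
    using x bij_betw_imp_surj_on[OF rhd_bij[OF x]]
    by (intro f_inv_into_f) (simp add: Phi_in_carrier)
  then show ?thesis
    by (simp add: sub_adjacent_def inv_solve_left' Phi_in_carrier x flip: m_assoc)
qed

lemma local_unit_idem: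
  assumes x: "x \<in> carrier G"
  shows "local_unit G rhd \<Phi> x \<odot> local_unit G rhd \<Phi> x = local_unit G rhd \<Phi> x"
    (is "?e \<odot> ?e = ?e")
proof -
  have e: "?e \<in> carrier G"
    by (rule local_unit_closed[OF x])
  have "x \<odot> (?e \<odot> ?e) = x \<odot> ?e"
    using sub_adjacent_assoc[OF x e e] by (simp add: sub_adjacent_local_unit x)
  moreover have "?e \<odot> ?e \<in> carrier G"
    using bij_betwE[OF sub_adjacent_bij[OF e]] e by blast
  ultimately show ?thesis
    using bij_betw_imp_inj_on[OF sub_adjacent_bij[OF x]] e by (simp add: inj_on_eq_iff x)
qed

end

theorem proposition3p1:
  fixes G :: "('a, 'm) monoid_scheme"
    and rhd :: "'a \<Rightarrow> 'a \<Rightarrow> 'a"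
    and \<Phi> :: "'a \<Rightarrow> 'a"
    and a :: 'a
  assumes "twisted_post_group G rhd \<Phi>"
    and "a \<in> carrier G"
  shows "group \<lparr>carrier = local_carrier G rhd \<Phi> a,
                monoid.mult = sub_adjacent G rhd \<Phi>,
                one = local_unit G rhd \<Phi> a\<rparr>"
proof -
  interpret twisted_post_group G rhd \<Phi>
    by (fact assms(1))
  show ?thesis
    unfolding local_carrier_def
    using assms(2)
    by (intro group_of_idempotent[where S = "carrier G"] sub_adjacent_bij sub_adjacent_assoc
        local_unit_closed local_unit_idem)
qed

end
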